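(* Let $\nu$ and $\kappa$ be infinite cardinals with $\nu^{<\kappa}=\nu$. Then for every ordinal $\xi$ with $2^{|\xi|}<\kappa$, every natural number $k$, and every non-$\nu$-special tree $T$, we have $T\to(\kappa+\xi)^2_k$: for every $c:[T]^2\to k$ there is a chain of order type $\kappa+\xi$ on whose pairs $c$ is constant.
   Context: A tree is a partial order in which the predecessors of each node are well-ordered. $T$ is $\nu$-special if it is a union of at most $\nu$ antichains, non-$\nu$-special otherwise. $\nu^{<\kappa}=\sup_{\mu<\kappa}\nu^\mu$ over cardinals $\mu<\kappa$. $[T]^2$ is the set of two-element chains of $T$. *)

theory Defs
  imports Main
begin

unbundle cardinal_syntax

text \<open>
  Cardinals are relations satisfying \<^const>\<open>Card_order\<close> and ordinals are relations
  satisfying \<^const>\<open>Well_order\<close>, both up to order isomorphism \<^const>\<open>ordIso\<close>.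
\<close>

text \<open>
  The competing upper bounds \<open>t\<close> live on the type of \<open>s\<close>. This loses no generality, since
  every cardinal below \<open>s\<close> has a copy there; see \<open>is_csup_least\<close>.
\<close>

definition is_csup :: "'a rel set \<Rightarrow> 'b rel \<Rightarrow> bool" where
  "is_csup S s \<longleftrightarrow>
     Card_order s \<and> (\<forall>r\<in>S. r \<le>o s) \<and>
     (\<forall>t :: 'b rel. Card_order t \<and> (\<forall>r\<in>S. r \<le>o t) \<longrightarrow> s \<le>o t)"

lemma is_csup_least:
  fixes s :: "'b rel" and t :: "'c rel"
  assumes s: "is_csup S s" and t: "Card_order t" and ub: "\<And>r. r \<in> S \<Longrightarrow> r \<le>o t"
  shows "s \<le>o t"
proof (rule ccontr)
  assume not_le: "\<not> s \<le>o t"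
  have cs: "Card_order s" using s by (simp add: is_csup_def)
  have tt: "|Field t| =o t" by (rule card_of_Field_ordIso[OF t])
  have ss: "|Field s| =o s" by (rule card_of_Field_ordIso[OF cs])
  have "t <o s"
    using not_le cs t by (simp add: card_order_on_well_order_on not_ordLeq_iff_ordLess)
  then have "|Field t| \<le>o |Field s|"
    using tt ss ordIso_ordLeq_trans ordIso_symmetric ordLeq_ordIso_trans ordLess_imp_ordLeq by blast
  then obtain f where f: "inj_on f (Field t)" "f ` Field t \<subseteq> Field s"
    using card_of_ordLeq[of "Field t" "Field s"] by blast
  have "|Field t| =o |f ` Field t|"
    using f(1) card_of_ordIso inj_on_imp_bij_betw by blast
  then have eq: "t =o |f ` Field t|"
    using tt ordIso_symmetric ordIso_transitive by blast
  have "\<forall>r\<in>S. r \<le>o |f ` Field t|"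
    using ub eq ordLeq_ordIso_trans by blast
  then have "s \<le>o |f ` Field t|"
    using s card_of_Card_order unfolding is_csup_def by blast
  then have "s \<le>o t"
    using eq ordIso_symmetric ordLeq_ordIso_trans by blast
  then show False using not_le by contradiction
qed

text \<open>
  \<open>is_cexp_less \<nu> \<kappa> s\<close> says that \<open>\<nu>\<^sup><\<^sup>\<kappa> = s\<close>. Every cardinal below \<open>\<kappa>\<close> has a copy on the
  type of \<open>\<kappa>\<close>, so \<open>\<mu>\<close> may be taken there.
\<close>

definition is_cexp_less :: "'n rel \<Rightarrow> 'k rel \<Rightarrow> 'b rel \<Rightarrow> bool" where
  "is_cexp_less \<nu> \<kappa> s \<longleftrightarrow> is_csup {\<nu> ^c \<mu> | \<mu> :: 'k rel. Card_order \<mu> \<and> \<mu> <o \<kappa>} s"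

text \<open>The ordinal sum, as in the session HOL-Cardinals.\<close>

definition osum :: "'a rel \<Rightarrow> 'b rel \<Rightarrow> ('a + 'b) rel" where
  "osum r r' = map_prod Inl Inl ` r \<union> map_prod Inr Inr ` r' \<union>
     {(Inl a, Inr a') | a a'. a \<in> Field r \<and> a' \<in> Field r'}"

text \<open>A tree is given by its reflexive order \<open>T\<close>; its set of nodes is \<^term>\<open>Field T\<close>.\<close>

definition is_tree :: "'a rel \<Rightarrow> bool" where
  "is_tree T \<longleftrightarrow> Partial_order T \<and> (\<forall>x\<in>Field T. Well_order (Restr T (underS T x)))"

definition antichain :: "'a rel \<Rightarrow> 'a set \<Rightarrow> bool" where
  "antichain T A \<longleftrightarrow> A \<subseteq> Field T \<and> (\<forall>x\<in>A. \<forall>y\<in>A. (x, y) \<in> T \<longrightarrow> x = y)"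

definition special :: "'n rel \<Rightarrow> 'a rel \<Rightarrow> bool" where
  "special \<nu> T \<longleftrightarrow> (\<exists>\<A>. |\<A>| \<le>o \<nu> \<and> (\<forall>A\<in>\<A>. antichain T A) \<and> \<Union>\<A> = Field T)"

definition chain_pairs :: "'a rel \<Rightarrow> 'a set set" where
  "chain_pairs T = {p \<in> Chains T. card p = 2}"

text \<open>\<open>T \<rightarrow> (\<alpha>)\<^sup>2\<^sub>k\<close>\<close>

definition tree_arrow :: "'a rel \<Rightarrow> 'b rel \<Rightarrow> nat \<Rightarrow> bool" where
  "tree_arrow T \<alpha> k \<longleftrightarrow>
     (\<forall>c :: 'a set \<Rightarrow> nat. c ` chain_pairs T \<subseteq> {..<k} \<longrightarrow>
        (\<exists>H\<in>Chains T. Restr T H =o \<alpha> \<and> (\<exists>i<k. \<forall>p\<in>chain_pairs T. p \<subseteq> H \<longrightarrow> c p = i)))"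

end

theory Submission
  imports Defs
begin

text \<open>
  Call a set of nodes small if its nodes can be given labels from \<open>\<nu>\<close> and tiny sets of
  predecessors such that comparable nodes never receive the same pair; a non-special tree is not
  small. A node \<open>t\<close> carries the filter generated by the sets of nodes that look like \<open>t\<close> over a
  tiny set of predecessors of \<open>t\<close>, and outside a small set these filters are proper. Iterating
  them along a list \<open>\<sigma>\<close> of colours gives a notion of \<open>\<sigma>\<close>-positive set. Choose \<open>\<sigma>\<close> maximal
  such that the nodes below which everything is \<open>\<sigma>\<close>-positive are not small. Then there are
  \<open>s\<close> below \<open>t\<close> among these nodes such that the pairs \<open>(x, t)\<close> with \<open>x\<close> from any
  \<open>\<sigma>\<close>-positive set below \<open>s\<close> have only colours of \<open>\<sigma>\<close>, up to a null set. The same holds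
  for all nodes looking like \<open>t\<close> over \<open>s\<close>, and they contain a set \<open>Z\<close> of type \<open>\<xi>\<^sup>n\<close> whose pairs
  are coloured according to the coordinate in which they split. As \<open>2\<^sup>|\<^sup>Z\<^sup>|\<close> is tiny, a positive set
  below \<open>s\<close> sees one colour per element of \<open>Z\<close>. Partitioning \<open>Z\<close> by that colour yields the
  homogeneous set of type \<open>\<xi>\<close>, and the positive set contains one of type \<open>\<kappa>\<close> of the same colour.
\<close>

subsection \<open>Tiny sets\<close>

text \<open>
  Unlike the sets of size less than \<open>\<kappa>\<close>, the tiny sets are closed under tiny unions even if \<open>\<kappa>\<close>
  is singular.
\<close>

definition tiny :: "'n set \<Rightarrow> 'b set \<Rightarrow> bool" where
  "tiny N X \<longleftrightarrow> |Func X N| \<le>o |N|"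

lemma card_of_finite_ordLeq:
  assumes "finite A" and "infinite B"
  shows "|A| \<le>o |B|"
  using assms finite_ordLess_infinite[OF card_of_Well_order card_of_Well_order, of A B]
  by (simp add: ordLess_imp_ordLeq Field_card_of)

lemma card_of_Pow_mono:
  assumes "|A| \<le>o |B|"
  shows "|Pow A| \<le>o |Pow B|"
proof -
  obtain f where f: "inj_on f A" "f ` A \<subseteq> B"
    using assms card_of_ordLeq[of A B] by blast
  then have "image f ` Pow A \<subseteq> Pow B" by blast
  then show ?thesis using inj_on_image_Pow[OF f(1)] card_of_ordLeq[of "Pow A" "Pow B"] by blast
qed

lemma card_of_Func_mono_dom:
  assumes "|X| \<le>o |Y|" and "N \<noteq> {}"
  shows "|Func X N| \<le>o |Func Y N|"
proof (cases "X = {}")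
  case True
  obtain n where "n \<in> N" using assms(2) by blast
  then have "(\<lambda>y. if y \<in> Y then n else undefined) \<in> Func Y N" by (simp add: Func_def)
  then have "Func Y N \<noteq> {}" by blast
  then show ?thesis using True by (simp add: Func_empty card_of_singl_ordLeq)
next
  case False
  then have "|N| ^c |X| \<le>o |N| ^c |Y|"
    using assms by (intro cexp_mono2') (auto simp: Field_card_of card_of_card_order_on card_of_empty3)
  then show ?thesis by (simp add: cexp_def Field_card_of)
qed

lemma tiny_mono: "tiny N Y \<Longrightarrow> |X| \<le>o |Y| \<Longrightarrow> N \<noteq> {} \<Longrightarrow> tiny N X"
  unfolding tiny_def by (rule ordLeq_transitive[OF card_of_Func_mono_dom])

lemma tiny_subset: "tiny N Y \<Longrightarrow> X \<subseteq> Y \<Longrightarrow> N \<noteq> {} \<Longrightarrow> tiny N X"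
  by (rule tiny_mono[OF _ card_of_mono1])

lemma card_of_Func_tiny:
  assumes "tiny N X" and "|L| \<le>o |N|"
  shows "|Func X L| \<le>o |N|"
proof -
  have "|L| ^c |X| \<le>o |N| ^c |X|"
    using assms(2) by (intro cexp_mono1) (auto simp: card_of_Card_order)
  then show ?thesis
    using assms(1) ordLeq_transitive[of "|Func X L|" "|Func X N|" "|N|"]
    by (simp add: tiny_def cexp_def Field_card_of)
qed

text \<open>A function on the union is determined by its restrictions to the \<open>X i\<close>, and
  each restriction is coded by an element of \<open>N\<close>. So the functions on the union inject
  into those from \<open>I\<close> to \<open>N\<close>.\<close>

lemma tiny_UN:
  fixes N :: "'n set" and X :: "'i \<Rightarrow> 'b set"
  assumes I: "tiny N I" and X: "\<And>i. i \<in> I \<Longrightarrow> tiny N (X i)"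
  shows "tiny N (\<Union>i\<in>I. X i)"
proof -
  have "\<forall>i\<in>I. \<exists>g. inj_on g (Func (X i) N) \<and> g ` Func (X i) N \<subseteq> N"
    using X unfolding tiny_def by (simp add: card_of_ordLeq)
  then obtain g where g: "\<And>i. i \<in> I \<Longrightarrow> inj_on (g i) (Func (X i) N)"
      "\<And>i. i \<in> I \<Longrightarrow> g i ` Func (X i) N \<subseteq> N"
    by metis
  define r where "r f i = (\<lambda>x. if x \<in> X i then f x else undefined)" for f :: "'b \<Rightarrow> 'n" and i
  have r: "r f i \<in> Func (X i) N" if "f \<in> Func (\<Union>i\<in>I. X i) N" "i \<in> I" for f i
    using that by (auto simp: Func_def r_def)
  define F where "F f = (\<lambda>i. if i \<in> I then g i (r f i) else undefined)" for f
  have "F ` Func (\<Union>i\<in>I. X i) N \<subseteq> Func I N"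
    using r g(2) by (fastforce simp: Func_def[of I] F_def)
  moreover have "inj_on F (Func (\<Union>i\<in>I. X i) N)"
  proof (rule inj_onI, rule ext)
    fix f f' x
    assume f: "f \<in> Func (\<Union>i\<in>I. X i) N" "f' \<in> Func (\<Union>i\<in>I. X i) N" "F f = F f'"
    show "f x = f' x"
    proof (cases "x \<in> (\<Union>i\<in>I. X i)")
      case True
      then obtain i where i: "i \<in> I" "x \<in> X i" by blast
      have "g i (r f i) = g i (r f' i)" using fun_cong[OF f(3), of i] i by (simp add: F_def)
      then have "r f i = r f' i" using g(1)[OF i(1)] r f i by (auto dest: inj_onD)
      then show ?thesis using i(2) unfolding r_def by meson
    next
      case False
      then show ?thesis using f unfolding Func_def by force
    qed
  qed
  ultimately have "|Func (\<Union>i\<in>I. X i) N| \<le>o |Func I N|"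
    using card_of_ordLeq by blast
  then show ?thesis using I ordLeq_transitive[of _ "|Func I N|"] unfolding tiny_def by blast
qed

lemma tiny_singleton: "tiny N {x}"
proof -
  have "inj_on (\<lambda>f. f x) (Func {x} N)"
    by (rule inj_onI, rule ext) (auto simp: Func_def, metis)
  moreover have "(\<lambda>f. f x) ` Func {x} N \<subseteq> N" by (auto simp: Func_def)
  ultimately show ?thesis unfolding tiny_def using card_of_ordLeq by blast
qed

lemma tiny_Un:
  assumes "infinite N" and "tiny N X" and "tiny N Y"
  shows "tiny N (X \<union> Y)"
proof -
  have two: "tiny N (UNIV :: bool set)"
  proof -
    have "inj_on (\<lambda>f. (f True, f False)) (Func (UNIV :: bool set) N)"
      by (rule inj_onI, rule ext) (metis (full_types) Pair_inject)
    moreover have "(\<lambda>f. (f True, f False)) ` Func UNIV N \<subseteq> N \<times> N" by (auto simp: Func_def)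
    ultimately have "|Func (UNIV :: bool set) N| \<le>o |N \<times> N|" using card_of_ordLeq by blast
    then show ?thesis using card_of_Times_same_infinite[OF assms(1)] ordLeq_ordIso_trans
      unfolding tiny_def by blast
  qed
  have "X \<union> Y = (\<Union>b\<in>UNIV. if b then X else Y)" by (auto split: if_splits)
  then show ?thesis using tiny_UN[OF two, of "\<lambda>b. if b then X else Y"] assms by simp
qed

lemma tiny_finite:
  assumes "infinite N" and "finite X"
  shows "tiny N X"
  using assms(2)
proof induction
  case empty
  have "N \<noteq> {}" using assms(1) by auto
  then show ?case by (simp add: tiny_def Func_empty card_of_singl_ordLeq)
next
  case (insert x X)
  then show ?case using tiny_Un[OF assms(1) tiny_singleton, of X x] by simp
qed

text \<open>A tiny subset cannot have size \<open>|N|\<close>, by Cantor's theorem, so it is the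
  image of a function on a proper initial segment of the cardinal order \<open>|N|\<close>. There
  are at most \<open>|N|\<close> segments, and at most \<open>|N|\<close> functions on each tiny
  one.\<close>

lemma card_of_tiny_subsets:
  fixes N :: "'n set"
  assumes inf: "infinite N"
  shows "|{X. X \<subseteq> N \<and> tiny N X}| \<le>o |N|"
proof -
  let ?r = "|N|"
  let ?I = "{a \<in> N. tiny N (underS ?r a)}"
  let ?F = "\<lambda>a. (\<lambda>f. f ` underS ?r a) ` Func (underS ?r a) N"
  have ne: "N \<noteq> {}" using inf by auto
  have "X \<in> (\<Union>a\<in>?I. ?F a)" if X: "X \<subseteq> N" "tiny N X" for X
  proof -
    have "\<not> |N| \<le>o |X|"
    proof
      assume "|N| \<le>o |X|"
      then have "tiny N N" using tiny_mono X ne by blast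
      moreover have "|UNIV :: bool set| \<le>o |N|"
        using inf by (simp add: card_of_finite_ordLeq)
      ultimately have "|Func N (UNIV :: bool set)| \<le>o |N|" using card_of_Func_tiny by blast
      then have "|Pow N| \<le>o |N|" using card_of_Pow_Func ordIso_ordLeq_trans by blast
      then show False using card_of_Pow not_ordLess_ordLeq by blast
    qed
    then have "|X| <o ?r" by (simp add: card_of_Well_order not_ordLeq_iff_ordLess)
    then obtain a where a: "a \<in> N" "|X| =o Restr ?r (underS ?r a)"
      using ordLess_iff_ordIso_Restr[of "|N|" "|X|"] card_of_Well_order Field_card_of by metis
    have refl: "(x, x) \<in> ?r" if "x \<in> underS ?r a" for x
      using card_of_Well_order[of N] that unfolding well_order_on_def linear_order_on_def
        partial_order_on_def preorder_on_def refl_on_def underS_def Field_def by blast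
    have fld: "Field (Restr ?r (underS ?r a)) = underS ?r a"
      using refl by (auto simp: underS_def Field_def)
    obtain f where f: "bij_betw f (underS ?r a) X"
      using ordIso_symmetric[OF a(2)] fld unfolding ordIso_def iso_def by (auto simp: Field_card_of)
    then have "|underS ?r a| \<le>o |X|" using card_of_ordIsoI ordIso_iff_ordLeq by blast
    then have t: "tiny N (underS ?r a)" using tiny_mono X ne by blast
    let ?f = "\<lambda>x. if x \<in> underS ?r a then f x else undefined"
    have "?f \<in> Func (underS ?r a) N" "X = ?f ` underS ?r a"
      using f X unfolding Func_def bij_betw_def by auto
    then show ?thesis using a(1) t by blast
  qed
  then have "{X. X \<subseteq> N \<and> tiny N X} \<subseteq> (\<Union>a\<in>?I. ?F a)" by blast
  moreover have "|\<Union>a\<in>?I. ?F a| \<le>o |N|"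
  proof (rule card_of_UNION_ordLeq_infinite[OF inf])
    show "|?I| \<le>o |N|" by (rule card_of_mono1) auto
    show "\<forall>a\<in>?I. |?F a| \<le>o |N|"
      by (auto simp: tiny_def intro: ordLeq_transitive[OF card_of_image])
  qed
  ultimately show ?thesis using ordLeq_transitive[OF card_of_mono1] by simp
qed

text \<open>Transfinite recursion: block \<open>a\<close> comes from \<open>step\<close> applied to
  the union of the earlier blocks, which is a tiny union of tiny sets. Only proper initial segments
  of \<alpha> have to be tiny, so \<alpha> may be \<kappa> itself.\<close>

lemma block_sequence:
  assumes \<alpha>: "Well_order \<alpha>" and init: "\<And>a. a \<in> Field \<alpha> \<Longrightarrow> tiny N (underS \<alpha> a)"
    and Q: "\<And>B. Q B \<Longrightarrow> tiny N B"
    and step: "\<And>p. p \<subseteq> Y \<Longrightarrow> tiny N p \<Longrightarrow> \<exists>B\<subseteq>Y. Q B \<and> (\<forall>y\<in>p. \<forall>x\<in>B. R y x)"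
  shows "\<exists>B. \<forall>a\<in>Field \<alpha>. B a \<subseteq> Y \<and> Q (B a) \<and> (\<forall>b\<in>underS \<alpha> a. \<forall>y\<in>B b. \<forall>x\<in>B a. R y x)"
proof -
  obtain F where F: "\<And>p. p \<subseteq> Y \<Longrightarrow> tiny N p \<Longrightarrow> F p \<subseteq> Y \<and> Q (F p) \<and> (\<forall>y\<in>p. \<forall>x\<in>F p. R y x)"
    using step by metis
  have wf: "wf (\<alpha> - Id)" using \<alpha> by (simp add: well_order_on_def)
  let ?H = "\<lambda>B a. F (\<Union>b\<in>underS \<alpha> a. B b)"
  define B where "B = wfrec (\<alpha> - Id) ?H"
  have "adm_wf (\<alpha> - Id) ?H"
    by (auto simp: adm_wf_def underS_def intro!: arg_cong[of _ _ F])
  then have B: "B a = F (\<Union>b\<in>underS \<alpha> a. B b)" for a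
    using wfrec_fixpoint[OF wf] unfolding B_def by (metis (no_types, lifting))
  have "a \<in> Field \<alpha> \<longrightarrow> B a \<subseteq> Y \<and> Q (B a) \<and> (\<forall>b\<in>underS \<alpha> a. \<forall>y\<in>B b. \<forall>x\<in>B a. R y x)" for a
    using wf
  proof (induction a)
    case (less a)
    show ?case
    proof
      assume a: "a \<in> Field \<alpha>"
      have IH: "B b \<subseteq> Y \<and> Q (B b)" if "b \<in> underS \<alpha> a" for b
        using that less[of b] by (auto simp: underS_def Field_def)
      let ?p = "\<Union>b\<in>underS \<alpha> a. B b"
      have "?p \<subseteq> Y" using IH by blast
      moreover have "tiny N ?p" using tiny_UN[OF init[OF a]] IH Q by blast
      ultimately show "B a \<subseteq> Y \<and> Q (B a) \<and> (\<forall>b\<in>underS \<alpha> a. \<forall>y\<in>B b. \<forall>x\<in>B a. R y x)"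
        using F[of ?p] B[of a] by auto
    qed
  qed
  then show ?thesis by blast
qed

subsection \<open>Small sets of nodes\<close>

lemma is_tree_trans:
  assumes "is_tree T" and "x \<in> underS T y" and "y \<in> underS T z"
  shows "x \<in> underS T z"
proof -
  have "trans T" "antisym T"
    using assms(1) by (simp_all add: is_tree_def partial_order_on_def preorder_on_def)
  then show ?thesis using assms(2,3) unfolding underS_def by (auto dest: transD antisymD)
qed

lemma is_tree_comparable:
  assumes "is_tree T" and "x \<in> underS T z" and "y \<in> underS T z"
  shows "x = y \<or> x \<in> underS T y \<or> y \<in> underS T x"
proof -
  have "z \<in> Field T" using assms(2) by (auto simp: underS_def Field_def)
  then have "Total (Restr T (underS T z))"
    using assms(1) unfolding is_tree_def well_order_on_def linear_order_on_def by blast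
  moreover have "(x, x) \<in> T" "(y, y) \<in> T"
    using assms unfolding is_tree_def partial_order_on_def preorder_on_def refl_on_def
    by (auto simp: underS_def Field_def)
  then have "x \<in> Field (Restr T (underS T z))" "y \<in> Field (Restr T (underS T z))"
    using assms(2,3) by (auto simp: Field_def)
  ultimately show ?thesis unfolding total_on_def underS_def by blast
qed

lemma is_tree_wf:
  assumes T: "is_tree T"
  shows "wf (T - Id)"
proof (rule wfI_min)
  fix x Q assume x: "x \<in> (Q :: 'a set)"
  show "\<exists>z\<in>Q. \<forall>y. (y, z) \<in> T - Id \<longrightarrow> y \<notin> Q"
  proof (cases "underS T x \<inter> Q = {}")
    case True
    then show ?thesis using x by (auto simp: underS_def)
  next
    case False
    then have "x \<in> Field T" by (auto simp: underS_def Field_def)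
    then have "wf (Restr T (underS T x) - Id)"
      using T unfolding is_tree_def well_order_on_def by blast
    then obtain z where z: "z \<in> underS T x \<inter> Q"
        "\<And>y. (y, z) \<in> Restr T (underS T x) - Id \<Longrightarrow> y \<notin> underS T x \<inter> Q"
      using False by (metis (no_types, lifting) wfE_min all_not_in_conv)
    have "y \<notin> Q" if y: "(y, z) \<in> T - Id" for y
    proof -
      have "y \<in> underS T x" using is_tree_trans[OF T, of y z x] y z(1) by (auto simp: underS_def)
      then show ?thesis using z y by blast
    qed
    then show ?thesis using z by blast
  qed
qed

section \<open>The ideal of small sets\<close>

locale tree =
  fixes N :: "'n set" and T :: "'a rel"
  assumes infinite_N: "infinite N" and is_tree: "is_tree T"
begin

lemma N_nonempty: "N \<noteq> {}"
  using infinite_N by auto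

lemmas below_trans = is_tree_trans[OF is_tree]

text \<open>Analogue of a nonstationary set: \<open>p\<close> is regressive, and on each fibre of
  \<open>p\<close> the labels split the nodes into at most \<open>|N|\<close> antichains.\<close>

definition small :: "'a set \<Rightarrow> bool" where
  "small B \<longleftrightarrow> (\<exists>p (l :: 'a \<Rightarrow> 'n).
     (\<forall>t\<in>B. p t \<subseteq> underS T t \<and> tiny N (p t) \<and> l t \<in> N) \<and>
     (\<forall>t\<in>B. \<forall>s\<in>B. s \<in> underS T t \<longrightarrow> p s = p t \<longrightarrow> l s \<noteq> l t))"

lemma small_subset:
  assumes "small B" and "A \<subseteq> B"
  shows "small A"
proof -
  obtain p and l :: "'a \<Rightarrow> 'n" where "\<forall>t\<in>B. p t \<subseteq> underS T t \<and> tiny N (p t) \<and> l t \<in> N"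
      "\<forall>t\<in>B. \<forall>s\<in>B. s \<in> underS T t \<longrightarrow> p s = p t \<longrightarrow> l s \<noteq> l t"
    using assms(1) unfolding small_def by auto
  then show ?thesis
    using assms(2) unfolding small_def by (intro exI[of _ p] exI[of _ l]) (simp add: subset_iff)
qed

text \<open>Labels are compared only within one fibre of \<open>p\<close>, so they may come from any
  type, and each fibre gets its own injection of its labels into \<open>N\<close>.\<close>

lemma smallI:
  fixes l :: "'a \<Rightarrow> 'z"
  assumes p: "\<And>t. t \<in> B \<Longrightarrow> p t \<subseteq> underS T t \<and> tiny N (p t)"
    and l: "\<And>q. q \<in> p ` B \<Longrightarrow> |l ` {t \<in> B. p t = q}| \<le>o |N|"
    and sep: "\<And>s t. s \<in> B \<Longrightarrow> t \<in> B \<Longrightarrow> s \<in> underS T t \<Longrightarrow> p s = p t \<Longrightarrow> l s \<noteq> l t"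
  shows "small B"
proof -
  have "\<forall>q\<in>p ` B. \<exists>g. inj_on g (l ` {t \<in> B. p t = q}) \<and> g ` l ` {t \<in> B. p t = q} \<subseteq> N"
    using l by (simp add: card_of_ordLeq)
  from bchoice[OF this] obtain g where
      "\<forall>q\<in>p ` B. inj_on (g q) (l ` {t \<in> B. p t = q}) \<and> g q ` l ` {t \<in> B. p t = q} \<subseteq> N" ..
  then have g: "\<And>q. q \<in> p ` B \<Longrightarrow> inj_on (g q) (l ` {t \<in> B. p t = q})"
         "\<And>q. q \<in> p ` B \<Longrightarrow> g q ` l ` {t \<in> B. p t = q} \<subseteq> N" by (metis (no_types, lifting))+
  have 1: "g (p t) (l t) \<in> N" if "t \<in> B" for t
    using g(2)[of "p t"] that by blast
  have 2: "g (p s) (l s) \<noteq> g (p t) (l t)"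
    if "s \<in> B" "t \<in> B" "s \<in> underS T t" "p s = p t" for s t
    using inj_onD[OF g(1)[of "p t"], of "l s" "l t"] sep[OF that] that by auto
  show ?thesis unfolding small_def
    using p 1 2 by (intro exI[of _ p] exI[of _ "\<lambda>t. g (p t) (l t)"]) blast
qed

text \<open>Each node uses the data of one chosen index \<open>j t\<close>, and this index joins its
  label. Nodes with equal labels then come from the same \<open>B i\<close>, where separation
  applies.\<close>

lemma small_UN:
  assumes I: "|I| \<le>o |N|" and B: "\<And>i. i \<in> I \<Longrightarrow> small (B i)"
  shows "small (\<Union>i\<in>I. B i)"
proof -
  obtain p l where
      p: "\<And>i t. i \<in> I \<Longrightarrow> t \<in> B i \<Longrightarrow> p i t \<subseteq> underS T t \<and> tiny N (p i t) \<and> l i t \<in> N"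
    and sep: "\<And>i s t. i \<in> I \<Longrightarrow> t \<in> B i \<Longrightarrow> s \<in> B i \<Longrightarrow> s \<in> underS T t \<Longrightarrow> p i s = p i t \<Longrightarrow> l i s \<noteq> l i t"
  proof -
    have "\<forall>i\<in>I. \<exists>pl. (\<forall>t\<in>B i. fst pl t \<subseteq> underS T t \<and> tiny N (fst pl t) \<and> snd pl t \<in> N) \<and>
      (\<forall>t\<in>B i. \<forall>s\<in>B i. s \<in> underS T t \<longrightarrow> fst pl s = fst pl t \<longrightarrow> snd pl s \<noteq> snd pl t)"
      using B unfolding small_def by fastforce
    from bchoice[OF this] obtain pl where
      "\<forall>i\<in>I. (\<forall>t\<in>B i. fst (pl i) t \<subseteq> underS T t \<and> tiny N (fst (pl i) t) \<and> snd (pl i) t \<in> N) \<and>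
      (\<forall>t\<in>B i. \<forall>s\<in>B i. s \<in> underS T t \<longrightarrow> fst (pl i) s = fst (pl i) t \<longrightarrow> snd (pl i) s \<noteq> snd (pl i) t)" ..
    then show ?thesis using that[of "\<lambda>i. fst (pl i)" "\<lambda>i. snd (pl i)"] by blast
  qed
  define j where "j t = (SOME i. i \<in> I \<and> t \<in> B i)" for t
  have j: "j t \<in> I \<and> t \<in> B (j t)" if t: "t \<in> (\<Union>i\<in>I. B i)" for t
  proof -
    have "\<exists>i. i \<in> I \<and> t \<in> B i" using t by blast
    then show ?thesis unfolding j_def by (rule someI_ex)
  qed
  show ?thesis
  proof (rule smallI[where p = "\<lambda>t. p (j t) t" and l = "\<lambda>t. (j t, l (j t) t)"])
    fix t assume "t \<in> (\<Union>i\<in>I. B i)"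
    then show "p (j t) t \<subseteq> underS T t \<and> tiny N (p (j t) t)" using j p by blast
  next
    fix q
    have "(\<lambda>t. (j t, l (j t) t)) ` {t \<in> (\<Union>i\<in>I. B i). p (j t) t = q} \<subseteq> I \<times> N"
      using j p by blast
    then have "|(\<lambda>t. (j t, l (j t) t)) ` {t \<in> (\<Union>i\<in>I. B i). p (j t) t = q}| \<le>o |I \<times> N|"
      by (rule card_of_mono1)
    moreover have "|I \<times> N| \<le>o |N|"
      using card_of_Sigma_ordLeq_infinite[OF infinite_N I, of "\<lambda>_. N"] card_of_refl ordIso_iff_ordLeq by blast
    ultimately show "|(\<lambda>t. (j t, l (j t) t)) ` {t \<in> (\<Union>i\<in>I. B i). p (j t) t = q}| \<le>o |N|"
      by (rule ordLeq_transitive)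
  next
    fix s t
    assume "s \<in> (\<Union>i\<in>I. B i)" "t \<in> (\<Union>i\<in>I. B i)" "s \<in> underS T t" "p (j s) s = p (j t) t"
    then show "(j s, l (j s) s) \<noteq> (j t, l (j t) t)"
      using sep[of "j t" t s] j by (metis Pair_inject)
  qed
qed

lemma small_Un:
  assumes "small A" and "small B"
  shows "small (A \<union> B)"
proof -
  have "|UNIV :: bool set| \<le>o |N|" using infinite_N by (simp add: card_of_finite_ordLeq)
  then have "small (\<Union>b\<in>UNIV. if b then A else B)" using assms by (intro small_UN) auto
  moreover have "(\<Union>b\<in>UNIV. if b then A else B) = A \<union> B" by (auto split: if_splits)
  ultimately show ?thesis by simp
qed

text \<open>Since the nodes in \<^term>\<open>p t\<close> lie below \<^term>\<open>t\<close>, the map to \<^term>\<open>N\<close> that is injective on chains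
  can be defined by recursion on \<^term>\<open>t\<close>, coding the label of \<^term>\<open>t\<close> with the tiny set of the
  codes of the nodes in \<^term>\<open>p t\<close>.\<close>

lemma small_Field_coding:
  assumes "small (Field T)"
  shows "\<exists>f. f ` Field T \<subseteq> N \<and> (\<forall>t\<in>Field T. \<forall>s\<in>underS T t. f s \<noteq> f t)"
proof -
  obtain p l where p: "\<And>t. t \<in> Field T \<Longrightarrow> p t \<subseteq> underS T t \<and> tiny N (p t) \<and> l t \<in> N"
    and sep: "\<And>s t. t \<in> Field T \<Longrightarrow> s \<in> Field T \<Longrightarrow> s \<in> underS T t \<Longrightarrow> p s = p t \<Longrightarrow> l s \<noteq> l t"
  proof -
    obtain p and l :: "'a \<Rightarrow> 'n" where
        "\<forall>t\<in>Field T. p t \<subseteq> underS T t \<and> tiny N (p t) \<and> l t \<in> N"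
        "\<forall>t\<in>Field T. \<forall>s\<in>Field T. s \<in> underS T t \<longrightarrow> p s = p t \<longrightarrow> l s \<noteq> l t"
      using assms unfolding small_def by auto
    then show ?thesis using that[of p l] by simp
  qed
  let ?P = "{X. X \<subseteq> N \<and> tiny N X}"
  have "|N \<times> ?P| \<le>o |N|"
    using card_of_Sigma_ordLeq_infinite[OF infinite_N, of N "\<lambda>_. ?P"] infinite_N
      card_of_tiny_subsets card_of_refl ordIso_iff_ordLeq by blast
  then have "\<exists>g. inj_on g (N \<times> ?P) \<and> g ` (N \<times> ?P) \<subseteq> N"
    by (simp only: card_of_ordLeq)
  then obtain en where en: "inj_on en (N \<times> ?P)" "en ` (N \<times> ?P) \<subseteq> N"
    by (elim exE conjE)
  \<comment> \<open>Intersecting with \<open>underS T t\<close> makes the recursion admissible for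
    arbitrary \<open>t\<close>; for nodes it changes nothing, as \<open>p t\<close> lies below
    \<open>t\<close>.\<close>
  let ?H = "\<lambda>f t. en (l t, f ` (p t \<inter> underS T t))"
  define f where "f = wfrec (T - Id) ?H"
  have "adm_wf (T - Id) ?H"
    by (auto simp: adm_wf_def underS_def intro!: arg_cong[of _ _ en])
  then have "f t = ?H f t" for t
    using wfrec_fixpoint[OF is_tree_wf[OF is_tree]] unfolding f_def by (metis (no_types, lifting))
  then have f: "f t = en (l t, f ` p t)" if "t \<in> Field T" for t
    using p[OF that] by (metis Int_absorb2)
  have fld: "s \<in> Field T" if "s \<in> underS T t" for s t
    using that by (auto simp: underS_def Field_def)
  have fN: "t \<in> Field T \<Longrightarrow> f t \<in> N \<and> f ` p t \<in> ?P" for t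
    using is_tree_wf[OF is_tree]
  proof (induction t)
    case (less t)
    have "f ` p t \<subseteq> N"
      using less.IH p[OF less.prems] fld by (auto simp: underS_def)
    moreover have "tiny N (f ` p t)"
      using tiny_mono p[OF less.prems] card_of_image N_nonempty by blast
    ultimately show ?case using f[OF less.prems] en(2) p[OF less.prems] by blast
  qed
  \<comment> \<open>Injectivity on chains: equal codes give equal labels and equal images of
    \<open>p s\<close> and \<open>p t\<close>. Members of these sets are comparable, so the
    induction hypothesis yields \<open>p s = p t\<close>, and \<open>sep\<close> leaves only
    \<open>s = t\<close>.\<close>
  have "s \<in> Field T \<Longrightarrow> t \<in> Field T \<Longrightarrow> s = t \<or> s \<in> underS T t \<or> t \<in> underS T s \<Longrightarrow> f s = f t \<Longrightarrow> s = t" for s t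
    using is_tree_wf[OF is_tree]
  proof (induction s arbitrary: t)
    case (less s)
    have eq: "l s = l t" "f ` p s = f ` p t"
      using inj_onD[OF en(1), of "(l s, f ` p s)" "(l t, f ` p t)"] less.prems f fN p by auto
    have m: "x = y" if x: "x \<in> p s" and y: "y \<in> p t" and xy: "f x = f y" for x y
    proof -
      have x': "x \<in> underS T s" and y': "y \<in> underS T t" using p less.prems x y by auto
      have "x = y \<or> x \<in> underS T y \<or> y \<in> underS T x"
        using less.prems(3) is_tree_comparable[OF is_tree] below_trans x' y' by metis
      then show ?thesis using less.IH[of x y] x' y' fld xy by (auto simp: underS_def)
    qed
    have "p s \<subseteq> p t"
    proof
      fix x assume x: "x \<in> p s"
      then have "f x \<in> f ` p t" using eq(2) by blast
      then show "x \<in> p t" using m[OF x] by force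
    qed
    moreover have "p t \<subseteq> p s"
    proof
      fix y assume y: "y \<in> p t"
      then have "f y \<in> f ` p s" using eq(2) by blast
      then show "y \<in> p s" using m[OF _ y] by force
    qed
    ultimately have "p s = p t" ..
    then show ?case using sep[of t s] sep[of s t] less.prems eq(1) by auto
  qed
  then have "\<forall>t\<in>Field T. \<forall>s\<in>underS T t. f s \<noteq> f t"
    using fld by (fastforce simp: underS_def)
  then show ?thesis using fN by blast
qed

lemma special_if_small_Field:
  assumes "small (Field T)" and "|N| =o \<nu>"
  shows "special \<nu> T"
proof -
  obtain f where f: "f ` Field T \<subseteq> N" "\<And>s t. t \<in> Field T \<Longrightarrow> s \<in> underS T t \<Longrightarrow> f s \<noteq> f t"
    using small_Field_coding[OF assms(1)] by metis
  let ?A = "(\<lambda>n. {t \<in> Field T. f t = n}) ` N"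
  have "|?A| \<le>o \<nu>" using card_of_image assms(2) ordLeq_ordIso_trans by blast
  moreover have "antichain T A" if "A \<in> ?A" for A
    using that f(2) unfolding antichain_def underS_def by fastforce
  moreover have "\<Union>?A = Field T" using f(1) by blast
  ultimately show ?thesis unfolding special_def by blast
qed

end

subsection \<open>Positive sets and homogeneous sets\<close>

locale coloured_tree = tree N T for N :: "'n set" and T :: "'a rel" +
  fixes c :: "'a \<Rightarrow> 'a \<Rightarrow> nat" and k :: nat
  assumes colour_less: "y \<in> underS T x \<Longrightarrow> c y x < k"
begin

definition like :: "('a \<Rightarrow> 'a \<Rightarrow> 'l) \<Rightarrow> 'a set \<Rightarrow> 'a \<Rightarrow> 'a set" where
  "like e p t = {x. p \<subseteq> underS T x \<and> (\<forall>y\<in>p. e y x = e y t)}"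

text \<open>Iterated product of the positivity notions of the filters, head of the list outermost,
  starting from the principal ultrafilter at \<open>t\<close>. A positive set contains the end of a
  descending path from \<open>t\<close>, with the list prescribing its colours to the earlier nodes
  of the path.\<close>

primrec pos :: "('a \<Rightarrow> 'a \<Rightarrow> 'l) \<Rightarrow> nat list \<Rightarrow> 'a \<Rightarrow> 'a set \<Rightarrow> bool" where
  "pos e [] t X \<longleftrightarrow> t \<in> X"
| "pos e (i # \<sigma>) t X \<longleftrightarrow> (\<forall>p. p \<subseteq> underS T t \<and> tiny N p \<longrightarrow>
     (\<exists>s \<in> underS T t \<inter> like e p t. pos e \<sigma> s (X \<inter> {x. c x t = i})))"

definition homog :: "nat \<Rightarrow> 'x rel \<Rightarrow> ('x \<Rightarrow> 'a) \<Rightarrow> bool" where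
  "homog i \<alpha> f \<longleftrightarrow> (\<forall>a\<in>Field \<alpha>. \<forall>b\<in>underS \<alpha> a. f b \<in> underS T (f a) \<and> c (f b) (f a) = i)"

text \<open>Such a set contains a copy of the power \<xi>^n, where n is the length of the list; a
  pair is coloured by the entry at the first coordinate where its two points differ.\<close>

primrec rich :: "'x rel \<Rightarrow> nat list \<Rightarrow> 'a set \<Rightarrow> bool" where
  "rich \<xi> [] Z \<longleftrightarrow> Z \<noteq> {}"
| "rich \<xi> (i # \<sigma>) Z \<longleftrightarrow> (\<exists>B. \<forall>a\<in>Field \<xi>. B a \<subseteq> Z \<and> rich \<xi> \<sigma> (B a) \<and>
     (\<forall>b\<in>underS \<xi> a. \<forall>y\<in>B b. \<forall>x\<in>B a. y \<in> underS T x \<and> c y x = i))"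

section \<open>Calculus of iterated positivity\<close>

lemma pos_cong:
  "(\<And>z. z \<in> underS T t \<Longrightarrow> e z = e' z) \<Longrightarrow> pos e \<sigma> t X = pos e' \<sigma> t X"
proof (induction \<sigma> arbitrary: t X)
  case (Cons i \<sigma>)
  have 1: "pos e \<sigma> s Y = pos e' \<sigma> s Y" if "s \<in> underS T t" for s Y
    using Cons.IH[of s] Cons.prems below_trans that by blast
  have 2: "like e p t = like e' p t" if "p \<subseteq> underS T t" for p
  proof -
    have "e y = e' y" if "y \<in> p" for y using Cons.prems \<open>p \<subseteq> _\<close> that by blast
    then show ?thesis by (auto simp: like_def)
  qed
  show ?case using 1 2 by auto
qed simp

lemma pos_ConsE:
  assumes "pos e (i # \<sigma>) t X" and "p \<subseteq> underS T t" and "tiny N p"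
  obtains s where "s \<in> underS T t" and "s \<in> like e p t" and "pos e \<sigma> s (X \<inter> {x. c x t = i})"
  using assms by auto

lemma pos_Cons_imp:
  assumes X: "pos e (i # \<sigma>) t X"
    and imp: "\<And>s. s \<in> underS T t \<Longrightarrow> pos e \<sigma> s (X \<inter> {x. c x t = i}) \<Longrightarrow> pos e \<sigma> s (Y \<inter> {x. c x t = i})"
  shows "pos e (i # \<sigma>) t Y"
  unfolding pos.simps
proof (intro allI impI, elim conjE)
  fix p assume "p \<subseteq> underS T t" "tiny N p"
  then show "\<exists>s\<in>underS T t \<inter> like e p t. pos e \<sigma> s (Y \<inter> {x. c x t = i})"
    by (rule pos_ConsE[OF X]) (use imp in blast)
qed

lemma pos_mono: "pos e \<sigma> t X \<Longrightarrow> X \<subseteq> Y \<Longrightarrow> pos e \<sigma> t Y"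
proof (induction \<sigma> arbitrary: t X Y)
  case (Cons i \<sigma>)
  have "X \<inter> {x. c x t = i} \<subseteq> Y \<inter> {x. c x t = i}" using Cons.prems(2) by blast
  then show ?case using pos_Cons_imp[OF Cons.prems(1)] Cons.IH by simp
qed auto

lemma pos_restrict:
  "pos e \<sigma> t X \<Longrightarrow> pos e \<sigma> t (X \<inter> insert t (underS T t))"
proof (induction \<sigma> arbitrary: t X)
  case (Cons i \<sigma>)
  have "pos e \<sigma> s (X \<inter> insert t (underS T t) \<inter> {x. c x t = i})"
    if "s \<in> underS T t" "pos e \<sigma> s (X \<inter> {x. c x t = i})" for s
    by (rule pos_mono[OF Cons.IH[OF that(2)]]) (use that(1) below_trans in auto)
  then show ?case using pos_Cons_imp[OF Cons.prems] by simp
qed auto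

lemma pos_nonempty: "pos e \<sigma> t X \<Longrightarrow> X \<noteq> {}"
proof (induction \<sigma> arbitrary: t X)
  case (Cons i \<sigma>)
  have "tiny N ({} :: 'a set)" using tiny_finite infinite_N by blast
  then obtain s where "pos e \<sigma> s (X \<inter> {x. c x t = i})"
    using pos_ConsE[OF Cons.prems, of "{}"] by blast
  then show ?case using Cons.IH by blast
qed auto

lemma like_like:
  assumes "s \<in> like e q t" and "p \<subseteq> q"
  shows "like e p s = like e p t"
  using assms by (auto simp: like_def subset_iff)

text \<open>Testing positivity on \<open>p \<union> q\<close> instead of \<open>q\<close> gives an
  \<open>s\<close> that looks like \<open>t\<close> over \<open>p\<close>. So
  \<open>like e p s\<close> and \<open>like e p t\<close> agree, and the claim passes down to
  \<open>s\<close>.\<close>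

lemma pos_Int_like:
  "pos e \<sigma> t X \<Longrightarrow> p \<subseteq> underS T t \<Longrightarrow> tiny N p \<Longrightarrow> pos e \<sigma> t (X \<inter> like e p t)"
proof (induction \<sigma> arbitrary: t X)
  case Nil
  then show ?case by (simp add: like_def)
next
  case (Cons i \<sigma>)
  show ?case unfolding pos.simps
  proof (intro allI impI, elim conjE)
    fix q assume q: "q \<subseteq> underS T t" "tiny N q"
    then have "p \<union> q \<subseteq> underS T t \<and> tiny N (p \<union> q)"
      using Cons.prems tiny_Un infinite_N by blast
    then obtain s where s: "s \<in> underS T t" "s \<in> like e (p \<union> q) t"
        "pos e \<sigma> s (X \<inter> {x. c x t = i})"
      using pos_ConsE[OF Cons.prems(1)] by blast
    have "p \<subseteq> underS T s" using s(2) by (simp add: like_def)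
    then have "pos e \<sigma> s (X \<inter> {x. c x t = i} \<inter> like e p s)"
      using Cons.IH s(3) Cons.prems(3) by blast
    then have "pos e \<sigma> s (X \<inter> like e p t \<inter> {x. c x t = i})"
      by (simp add: like_like[OF s(2)] Int_ac)
    moreover have "s \<in> like e q t" using s(2) by (auto simp: like_def)
    ultimately show "\<exists>s\<in>underS T t \<inter> like e q t. pos e \<sigma> s (X \<inter> like e p t \<inter> {x. c x t = i})"
      using s(1) by blast
  qed
qed

text \<open>Completeness of the null ideal: the witnesses \<open>p h\<close> for nullity of the
  single sets have a tiny union, so one \<open>s\<close> looks like \<open>t\<close> over all of
  them. By induction some single set is positive at \<open>s\<close>, against its witness.\<close>

lemma pos_UN:
  "tiny N I \<Longrightarrow> pos e \<sigma> t (\<Union>h\<in>I. X h) \<Longrightarrow> \<exists>h\<in>I. pos e \<sigma> t (X h)"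
proof (induction \<sigma> arbitrary: t X)
  case (Cons i \<sigma>)
  show ?case
  proof (rule ccontr)
    assume "\<not> ?thesis"
    then have "\<forall>h\<in>I. \<exists>p. p \<subseteq> underS T t \<and> tiny N p \<and>
        (\<forall>s\<in>underS T t \<inter> like e p t. \<not> pos e \<sigma> s (X h \<inter> {x. c x t = i}))" by auto
    from bchoice[OF this] obtain p where p: "\<forall>h\<in>I. p h \<subseteq> underS T t \<and> tiny N (p h) \<and>
        (\<forall>s\<in>underS T t \<inter> like e (p h) t. \<not> pos e \<sigma> s (X h \<inter> {x. c x t = i}))" ..
    let ?p = "\<Union>h\<in>I. p h"
    have "?p \<subseteq> underS T t" using p by blast
    moreover have "tiny N ?p" using p Cons.prems(1) by (intro tiny_UN) auto
    ultimately obtain s where s: "s \<in> underS T t" "s \<in> like e ?p t"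
        "pos e \<sigma> s ((\<Union>h\<in>I. X h) \<inter> {x. c x t = i})"
      using pos_ConsE[OF Cons.prems(2)] by blast
    have "(\<Union>h\<in>I. X h) \<inter> {x. c x t = i} = (\<Union>h\<in>I. X h \<inter> {x. c x t = i})" by blast
    then obtain h where h: "h \<in> I" "pos e \<sigma> s (X h \<inter> {x. c x t = i})"
      using Cons.IH[OF Cons.prems(1), of s "\<lambda>h. X h \<inter> {x. c x t = i}"] s(3) by auto
    have "s \<in> like e (p h) t" using s(2) h(1) by (auto simp: like_def)
    then show False using p h s(1) by blast
  qed
qed auto

section \<open>Homogeneous and rich sets from positivity\<close>

lemma pos_step:
  assumes e: "\<And>y x x'. e y x = e y x' \<Longrightarrow> c y x = c y x'"
    and "pos e (i # \<sigma>) t X" and p: "p \<subseteq> {y \<in> underS T t. c y t = i}" "tiny N p"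
  obtains s where "s \<in> underS T t"
    "pos e \<sigma> s (X \<inter> {x. c x t = i} \<inter> {x. \<forall>y\<in>p. y \<in> underS T x \<and> c y x = i})"
proof -
  have "p \<subseteq> underS T t" using p(1) by blast
  then obtain s where s: "s \<in> underS T t" "s \<in> like e p t" "pos e \<sigma> s (X \<inter> {x. c x t = i})"
    using pos_ConsE[OF assms(2)] p(2) by blast
  have "p \<subseteq> underS T s" using s(2) by (simp add: like_def)
  then have "pos e \<sigma> s (X \<inter> {x. c x t = i} \<inter> like e p s)"
    using pos_Int_like s(3) p(2) by blast
  moreover have "like e p s = like e p t" using like_like s(2) by blast
  \<comment> \<open>As labels determine colours, a node that looks like \<open>t\<close> over
    \<open>p\<close> inherits from \<open>t\<close> the colour \<open>i\<close> to every node of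
    \<open>p\<close>.\<close>
  moreover have "like e p t \<subseteq> {x. \<forall>y\<in>p. y \<in> underS T x \<and> c y x = i}"
  proof
    fix x assume "x \<in> like e p t"
    then have x: "p \<subseteq> underS T x" "\<And>y. y \<in> p \<Longrightarrow> e y x = e y t" by (auto simp: like_def)
    have "c y x = i" if "y \<in> p" for y
      using e[OF x(2)[OF that]] p(1) that by auto
    then show "x \<in> {x. \<forall>y\<in>p. y \<in> underS T x \<and> c y x = i}" using x(1) by blast
  qed
  ultimately have "pos e \<sigma> s (X \<inter> {x. c x t = i} \<inter> {x. \<forall>y\<in>p. y \<in> underS T x \<and> c y x = i})"
    by (elim pos_mono) auto
  then show ?thesis using that s(1) by blast
qed

text \<open>At the level of \<sigma> where \<open>i\<close> sits, the chain is built from single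
  nodes joined to \<open>t\<close> in colour \<open>i\<close>. A new node looks like
  \<open>t\<close> over the earlier ones, hence has colour \<open>i\<close> to them too. Levels of
  other colours are passed by moving down to a witness.\<close>

lemma pos_homog:
  assumes e: "\<And>y x x'. e y x = e y x' \<Longrightarrow> c y x = c y x'"
    and \<kappa>: "Well_order \<kappa>" "\<And>a. a \<in> Field \<kappa> \<Longrightarrow> tiny N (underS \<kappa> a)"
  shows "pos e \<sigma> t X \<Longrightarrow> i \<in> set \<sigma> \<Longrightarrow> \<exists>f. f ` Field \<kappa> \<subseteq> X \<and> homog i \<kappa> f"
proof (induction \<sigma> arbitrary: t X)
  case (Cons j \<sigma>)
  show ?case
  proof (cases "i = j")
    case True
    let ?Y = "X \<inter> {x \<in> underS T t. c x t = i}"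
    have "\<exists>B. \<forall>a\<in>Field \<kappa>. B a \<subseteq> ?Y \<and> (\<exists>x. B a = {x}) \<and>
        (\<forall>b\<in>underS \<kappa> a. \<forall>y\<in>B b. \<forall>x\<in>B a. y \<in> underS T x \<and> c y x = i)"
    proof (rule block_sequence[OF \<kappa>])
      fix p assume p: "p \<subseteq> ?Y" "tiny N p"
      obtain s where s: "s \<in> underS T t"
          "pos e \<sigma> s (X \<inter> {x. c x t = i} \<inter> {x. \<forall>y\<in>p. y \<in> underS T x \<and> c y x = i})"
        by (rule pos_step[OF e Cons.prems(1), of p]) (use p True in auto)
      then obtain x where x: "x \<in> X" "c x t = i" "\<forall>y\<in>p. y \<in> underS T x \<and> c y x = i"
          "x \<in> insert s (underS T s)"
        using pos_nonempty[OF pos_restrict[OF s(2)]] by blast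
      then have "{x} \<subseteq> ?Y" using s(1) below_trans by auto
      then show "\<exists>B\<subseteq>?Y. (\<exists>x. B = {x}) \<and> (\<forall>y\<in>p. \<forall>x\<in>B. y \<in> underS T x \<and> c y x = i)"
        using x(3) by (intro exI[of _ "{x}"]) auto
    qed (auto simp: tiny_singleton)
    then obtain B where B: "\<forall>a\<in>Field \<kappa>. B a \<subseteq> ?Y \<and> (\<exists>x. B a = {x}) \<and>
        (\<forall>b\<in>underS \<kappa> a. \<forall>y\<in>B b. \<forall>x\<in>B a. y \<in> underS T x \<and> c y x = i)" ..
    have m: "the_elem (B a) \<in> B a" if "a \<in> Field \<kappa>" for a
      using B that by force
    have "underS \<kappa> a \<subseteq> Field \<kappa>" for a by (auto simp: underS_def Field_def)
    then have "homog i \<kappa> (\<lambda>a. the_elem (B a))"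
      unfolding homog_def using B m by blast
    moreover have "(\<lambda>a. the_elem (B a)) ` Field \<kappa> \<subseteq> X" using B m by blast
    ultimately show ?thesis by blast
  next
    case False
    have "tiny N ({} :: 'a set)" using tiny_finite infinite_N by blast
    then obtain s where "pos e \<sigma> s (X \<inter> {x. c x t = j})"
      using pos_ConsE[OF Cons.prems(1), of "{}"] by blast
    then show ?thesis using Cons.IH[of s "X \<inter> {x. c x t = j}"] Cons.prems(2) False by auto
  qed
qed simp

text \<open>Blocks are built as in \<open>pos_homog\<close>, but each is itself rich for the tail of
  the list, by induction. The size bound keeps the blocks tiny; its finite alternative covers finite
  \<xi>, whose powers can be larger than \<xi>.\<close>

lemma pos_rich:
  assumes e: "\<And>y x x'. e y x = e y x' \<Longrightarrow> c y x = c y x'"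
    and \<xi>: "Well_order \<xi>" "tiny N (Field \<xi>)"
  shows "pos e \<sigma> t X \<Longrightarrow> \<exists>Z\<subseteq>X. rich \<xi> \<sigma> Z \<and> (finite Z \<or> |Z| \<le>o |Field \<xi>| )"
proof (induction \<sigma> arbitrary: t X)
  case Nil
  then show ?case by (intro exI[of _ "{t}"]) auto
next
  case (Cons i \<sigma>)
  let ?Y = "X \<inter> {x \<in> underS T t. c x t = i}"
  let ?Q = "\<lambda>B. rich \<xi> \<sigma> B \<and> (finite B \<or> |B| \<le>o |Field \<xi>| )"
  have "\<exists>B. \<forall>a\<in>Field \<xi>. B a \<subseteq> ?Y \<and> ?Q (B a) \<and>
      (\<forall>b\<in>underS \<xi> a. \<forall>y\<in>B b. \<forall>x\<in>B a. y \<in> underS T x \<and> c y x = i)"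
  proof (rule block_sequence[OF \<xi>(1)])
    fix a assume "a \<in> Field \<xi>"
    have "underS \<xi> a \<subseteq> Field \<xi>" by (auto simp: underS_def Field_def)
    then show "tiny N (underS \<xi> a)" using tiny_subset[OF \<xi>(2)] N_nonempty by blast
  next
    fix B assume "?Q B"
    then show "tiny N B" using tiny_finite[OF infinite_N] tiny_mono[OF \<xi>(2)] N_nonempty by blast
  next
    fix p assume p: "p \<subseteq> ?Y" "tiny N p"
    obtain s where s: "s \<in> underS T t"
        "pos e \<sigma> s (X \<inter> {x. c x t = i} \<inter> {x. \<forall>y\<in>p. y \<in> underS T x \<and> c y x = i})"
      by (rule pos_step[OF e Cons.prems(1), of p]) (use p in auto)
    obtain B where B: "?Q B" "B \<subseteq> X \<inter> {x. c x t = i} \<inter> {x. \<forall>y\<in>p. y \<in> underS T x \<and> c y x = i} \<inter>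
        insert s (underS T s)"
      using Cons.IH[OF pos_restrict[OF s(2)]] by blast
    have "insert s (underS T s) \<subseteq> underS T t" using s(1) below_trans by blast
    then show "\<exists>B\<subseteq>?Y. ?Q B \<and> (\<forall>y\<in>p. \<forall>x\<in>B. y \<in> underS T x \<and> c y x = i)"
      using B by (intro exI[of _ B]) blast
  qed
  then obtain B where B: "\<forall>a\<in>Field \<xi>. B a \<subseteq> ?Y \<and> ?Q (B a) \<and>
      (\<forall>b\<in>underS \<xi> a. \<forall>y\<in>B b. \<forall>x\<in>B a. y \<in> underS T x \<and> c y x = i)" ..
  let ?Z = "\<Union>a\<in>Field \<xi>. B a"
  have "?Z \<subseteq> X" using B by blast
  moreover have "rich \<xi> (i # \<sigma>) ?Z"
    using B unfolding rich.simps by (intro exI[of _ B]) blast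
  moreover have "finite ?Z \<or> |?Z| \<le>o |Field \<xi>|"
  proof (cases "finite (Field \<xi>)")
    case True
    then have "finite (B a)" if "a \<in> Field \<xi>" for a
      using B that card_of_ordLeq_finite by blast
    then show ?thesis using True by blast
  next
    case False
    then have "\<forall>a\<in>Field \<xi>. |B a| \<le>o |Field \<xi>|"
      using B card_of_finite_ordLeq by blast
    then show ?thesis
      using card_of_UNION_ordLeq_infinite[OF False] card_of_refl ordIso_iff_ordLeq by blast
  qed
  ultimately show ?case by blast
qed

text \<open>Pigeonhole for powers of \<xi>: if some block misses the colour \<open>i\<close>,
  continue inside it with the tail of the list. Otherwise take one point of colour \<open>i\<close>
  from each block, since pairs across blocks have colour \<open>i\<close>.\<close>

lemma rich_partition:
  "rich \<xi> \<sigma> Z \<Longrightarrow> h ` Z \<subseteq> set \<sigma> \<Longrightarrow>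
    \<exists>i\<in>set \<sigma>. \<exists>f. f ` Field \<xi> \<subseteq> {z \<in> Z. h z = i} \<and> homog i \<xi> f"
proof (induction \<sigma> arbitrary: Z)
  case (Cons i \<sigma>)
  obtain B where B: "\<forall>a\<in>Field \<xi>. B a \<subseteq> Z \<and> rich \<xi> \<sigma> (B a) \<and>
      (\<forall>b\<in>underS \<xi> a. \<forall>y\<in>B b. \<forall>x\<in>B a. y \<in> underS T x \<and> c y x = i)"
    using Cons.prems(1) unfolding rich.simps ..
  show ?case
  proof (cases "\<exists>a\<in>Field \<xi>. i \<notin> h ` B a")
    case True
    then obtain a where a: "a \<in> Field \<xi>" "i \<notin> h ` B a" by blast
    have Ba: "B a \<subseteq> Z" "rich \<xi> \<sigma> (B a)" using B a(1) by auto
    then have "h ` B a \<subseteq> set \<sigma>" using a(2) Cons.prems(2) by auto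
    then obtain j f where "j \<in> set \<sigma>" "f ` Field \<xi> \<subseteq> {z \<in> B a. h z = j}" "homog j \<xi> f"
      using Cons.IH[OF Ba(2)] by blast
    then show ?thesis using Ba(1)
      by (intro bexI[of _ j] exI[of _ f]) auto
  next
    case False
    then have "\<forall>a\<in>Field \<xi>. \<exists>x. x \<in> B a \<and> h x = i" by blast
    from bchoice[OF this] obtain f where f: "\<forall>a\<in>Field \<xi>. f a \<in> B a \<and> h (f a) = i" ..
    have "underS \<xi> a \<subseteq> Field \<xi>" for a by (auto simp: underS_def Field_def)
    then have "homog i \<xi> f" unfolding homog_def using B f by blast
    moreover have "f ` Field \<xi> \<subseteq> {z \<in> Z. h z = i}" using f B by blast
    ultimately show ?thesis by auto
  qed
qed simp

section \<open>Reflection and maximal colour patterns\<close>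

lemma small_nonreflecting:
  assumes L: "\<And>x y. y \<in> underS T x \<Longrightarrow> e y x \<in> L" "finite L"
  shows "small {t \<in> S. \<exists>p \<subseteq> underS T t. tiny N p \<and> underS T t \<inter> S \<inter> like e p t = {}}" (is "small ?B")
proof -
  have "\<forall>t\<in>?B. \<exists>p. p \<subseteq> underS T t \<and> tiny N p \<and> underS T t \<inter> S \<inter> like e p t = {}" by blast
  from bchoice[OF this] obtain p where p: "\<forall>t\<in>?B. p t \<subseteq> underS T t \<and> tiny N (p t) \<and>
      underS T t \<inter> S \<inter> like e (p t) t = {}" ..
  \<comment> \<open>Pressing down: the label of \<open>t\<close> is its row of labels over the
    witness \<open>p t\<close>, a function from a tiny set to the finite \<open>L\<close>. If
    \<open>s\<close> below \<open>t\<close> had the same witness and row, it would look like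
    \<open>t\<close> over \<open>p t\<close> and lie in \<open>S\<close>, against the choice of
    \<open>p t\<close>.\<close>
  define l where "l t = (\<lambda>y. if y \<in> p t then e y t else undefined)" for t
  show ?thesis
  proof (rule smallI[of _ p l])
    fix q assume "q \<in> p ` ?B"
    then have "tiny N q" using p by blast
    then have "|Func q L| \<le>o |N|"
      using card_of_Func_tiny card_of_finite_ordLeq[OF L(2) infinite_N] by blast
    moreover have "l ` {t \<in> ?B. p t = q} \<subseteq> Func q L"
    proof (rule image_subsetI, elim CollectE conjE)
      fix t assume "t \<in> S" "\<exists>p\<subseteq>underS T t. tiny N p \<and> underS T t \<inter> S \<inter> like e p t = {}" "p t = q"
      then have "q \<subseteq> underS T t" using p by blast
      then show "l t \<in> Func q L" using L(1) \<open>p t = q\<close> by (auto simp: Func_def l_def)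
    qed
    ultimately show "|l ` {t \<in> ?B. p t = q}| \<le>o |N|"
      using ordLeq_transitive[OF card_of_mono1] by blast
  next
    fix s t assume st: "s \<in> ?B" "t \<in> ?B" "s \<in> underS T t" "p s = p t"
    show "l s \<noteq> l t"
    proof
      assume "l s = l t"
      have "e y s = e y t" if "y \<in> p t" for y
        using fun_cong[OF \<open>l s = l t\<close>, of y] st(4) that by (simp add: l_def)
      moreover have "p t \<subseteq> underS T s" using p st(1,4) by auto
      ultimately have "s \<in> like e (p t) t" by (simp add: like_def)
      then show False using p st by blast
    qed
  qed (use p in blast)
qed

text \<open>
  The filters at \<open>y\<close> depend only on the labels \<open>e z\<close> for \<open>z\<close> below \<open>y\<close>. So the label \<open>e y x\<close> can,
  besides the colour of \<open>(y, x)\<close>, record which colours occur positively often between \<open>x\<close> and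
  the nodes below \<open>y\<close>.
\<close>

lemma exists_labelling:
  obtains e :: "'a \<Rightarrow> 'a \<Rightarrow> nat \<times> (nat list \<times> nat) set" and L
  where "finite L" and "\<And>x y. y \<in> underS T x \<Longrightarrow> e y x \<in> L"
    and "\<And>x x' y. e y x = e y x' \<Longrightarrow> c y x = c y x'"
    and "\<And>x x' y \<sigma> j. e y x = e y x' \<Longrightarrow> distinct \<sigma> \<Longrightarrow> set \<sigma> \<subseteq> {..<k} \<Longrightarrow> j < k \<Longrightarrow>
      pos e \<sigma> y {u. c u x = j} \<longleftrightarrow> pos e \<sigma> y {u. c u x' = j}"
proof -
  \<comment> \<open>Only lists without repetition are recorded, which keeps the set of labels
    finite.\<close>
  let ?D = "{\<sigma>. set \<sigma> \<subseteq> {..<k} \<and> distinct \<sigma>} \<times> {..<k}"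
  let ?H = "\<lambda>(e :: 'a \<Rightarrow> 'a \<Rightarrow> nat \<times> (nat list \<times> nat) set) y x.
    (c y x, {(\<sigma>, j). (\<sigma>, j) \<in> ?D \<and> pos e \<sigma> y {u. c u x = j}})"
  define e where "e = wfrec (T - Id) ?H"
  have "adm_wf (T - Id) ?H"
    unfolding adm_wf_def
  proof (intro allI impI)
    fix f g :: "'a \<Rightarrow> 'a \<Rightarrow> nat \<times> (nat list \<times> nat) set" and y
    assume "\<forall>z. (z, y) \<in> T - Id \<longrightarrow> f z = g z"
    then have "pos f \<sigma> y X = pos g \<sigma> y X" for \<sigma> X
      by (intro pos_cong) (auto simp: underS_def)
    then show "?H f y = ?H g y" by simp
  qed
  then have e: "e = ?H e"
    unfolding e_def by (rule wfrec_fixpoint[OF is_tree_wf[OF is_tree]])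
  have e1: "fst (e y x) = c y x" for x y
    by (subst e) simp
  have e2: "snd (e y x) = {(\<sigma>, j). (\<sigma>, j) \<in> ?D \<and> pos e \<sigma> y {u. c u x = j}}" for x y
    by (subst e) simp
  have "finite ?D" by (intro finite_cartesian_product finite_subset_distinct) simp_all
  show ?thesis
  proof (rule that[of "{..<k} \<times> Pow ?D" e])
    show "finite ({..<k} \<times> Pow ?D)" using \<open>finite ?D\<close> by blast
    show "e y x \<in> {..<k} \<times> Pow ?D" if "y \<in> underS T x" for x y
    proof -
      have "fst (e y x) \<in> {..<k}" using e1 colour_less[OF that] by simp
      moreover have "snd (e y x) \<in> Pow ?D" unfolding e2 by blast
      ultimately show ?thesis by (simp only: mem_Times_iff)
    qed
    show "c y x = c y x'" if "e y x = e y x'" for x x' y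
      using e1[of y x] e1[of y x'] that by simp
    show "pos e \<sigma> y {u. c u x = j} \<longleftrightarrow> pos e \<sigma> y {u. c u x' = j}"
      if "e y x = e y x'" "distinct \<sigma>" "set \<sigma> \<subseteq> {..<k}" "j < k" for x x' y \<sigma> j
    proof -
      have "(\<sigma>, j) \<in> snd (e y x) \<longleftrightarrow> (\<sigma>, j) \<in> snd (e y x')" using that(1) by simp
      then show ?thesis unfolding e2 using that(2-4) by simp
    qed
  qed
qed

text \<open>A list without repetition over \<open>k\<close> colours has length at most
  \<open>k\<close>, and the empty list qualifies, so a longest non-small pattern exists. Maximality
  is applied to extensions at the head, the outermost level.\<close>

lemma exists_maximal_pattern:
  fixes e :: "'a \<Rightarrow> 'a \<Rightarrow> 'l"
  assumes "\<not> small (Field T)"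
  obtains \<sigma> where "distinct \<sigma>" and "set \<sigma> \<subseteq> {..<k}" and "\<not> small {t \<in> Field T. pos e \<sigma> t UNIV}"
    and "\<And>j. j < k \<Longrightarrow> j \<notin> set \<sigma> \<Longrightarrow> small {t \<in> Field T. pos e (j # \<sigma>) t UNIV}"
proof -
  let ?P = "\<lambda>\<sigma>. distinct \<sigma> \<and> set \<sigma> \<subseteq> {..<k} \<and> \<not> small {t \<in> Field T. pos e \<sigma> t UNIV}"
  have "length \<sigma> < Suc k" if "?P \<sigma>" for \<sigma>
    using that card_mono[of "{..<k}" "set \<sigma>"] by (simp add: distinct_card)
  moreover have "?P []" using assms by simp
  ultimately have "\<exists>\<sigma>. ?P \<sigma> \<and> (\<forall>\<tau>. ?P \<tau> \<longrightarrow> length \<tau> \<le> length \<sigma>)"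
    using Lattices_Big.ex_has_greatest_nat[of ?P "[]" length "Suc k"] by blast
  then obtain \<sigma> where \<sigma>: "?P \<sigma>" "\<And>\<tau>. ?P \<tau> \<Longrightarrow> length \<tau> \<le> length \<sigma>" by blast
  have "small {t \<in> Field T. pos e (j # \<sigma>) t UNIV}" if "j < k" "j \<notin> set \<sigma>" for j
  proof (rule ccontr)
    assume "\<not> ?thesis"
    then have "?P (j # \<sigma>)" using that \<sigma>(1) by simp
    then show False using \<sigma>(2) by fastforce
  qed
  then show ?thesis using that \<sigma>(1) by blast
qed

lemma exists_homog:
  assumes \<kappa>: "Well_order \<kappa>" "\<And>a. a \<in> Field \<kappa> \<Longrightarrow> tiny N (underS \<kappa> a)"
    and \<xi>: "Well_order \<xi>" "tiny N (Pow (Field \<xi>))"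
    and large: "\<not> small (Field T)"
  obtains i f g where "i < k" and "homog i \<kappa> f" and "homog i \<xi> g" and "f ` Field \<kappa> \<subseteq> Field T"
    and "\<And>a b. a \<in> Field \<kappa> \<Longrightarrow> b \<in> Field \<xi> \<Longrightarrow> f a \<in> underS T (g b) \<and> c (f a) (g b) = i"
proof -
  obtain e :: "'a \<Rightarrow> 'a \<Rightarrow> nat \<times> (nat list \<times> nat) set" and L where L: "finite L" "\<And>x y. y \<in> underS T x \<Longrightarrow> e y x \<in> L"
    and ec: "\<And>x x' y. e y x = e y x' \<Longrightarrow> c y x = c y x'"
    and epos: "\<And>x x' y \<sigma> j. e y x = e y x' \<Longrightarrow> distinct \<sigma> \<Longrightarrow> set \<sigma> \<subseteq> {..<k} \<Longrightarrow> j < k \<Longrightarrow>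
      pos e \<sigma> y {u. c u x = j} \<longleftrightarrow> pos e \<sigma> y {u. c u x' = j}"
    by (rule exists_labelling) (rule that)
  obtain \<sigma> where \<sigma>: "distinct \<sigma>" "set \<sigma> \<subseteq> {..<k}" "\<not> small {t \<in> Field T. pos e \<sigma> t UNIV}"
      "\<And>j. j < k \<Longrightarrow> j \<notin> set \<sigma> \<Longrightarrow> small {t \<in> Field T. pos e (j # \<sigma>) t UNIV}"
    by (rule exists_maximal_pattern[OF large, of e]) (rule that)
  let ?S = "{t \<in> Field T. pos e \<sigma> t UNIV}"
  let ?J = "{j. j < k \<and> j \<notin> set \<sigma>}"
  let ?X = "{t \<in> ?S. \<exists>p \<subseteq> underS T t. tiny N p \<and> underS T t \<inter> ?S \<inter> like e p t = {}}"
  have "small ?X" by (rule small_nonreflecting[of e L]) (use L in auto)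
  moreover have "small (\<Union>j\<in>?J. {t \<in> Field T. pos e (j # \<sigma>) t UNIV})"
    using \<sigma>(4) card_of_finite_ordLeq[OF _ infinite_N, of ?J] by (intro small_UN) auto
  \<comment> \<open>The nodes of \<open>?S\<close> that do not reflect \<open>?S\<close> and those
    positive for a longer pattern are discarded; both sorts are small, so some \<open>t\<close>
    remains.\<close>
  ultimately have "\<not> ?S \<subseteq> ?X \<union> (\<Union>j\<in>?J. {t \<in> Field T. pos e (j # \<sigma>) t UNIV})"
    using small_Un small_subset \<sigma>(3) by meson
  then obtain t where t: "t \<in> ?S" "t \<notin> ?X" "\<And>j. j \<in> ?J \<Longrightarrow> \<not> pos e (j # \<sigma>) t UNIV" by blast
  \<comment> \<open>For each colour \<open>j\<close> outside \<sigma>, a tiny \<open>p j\<close>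
    witnesses that \<open>j # \<sigma>\<close> fails at \<open>t\<close>. Reflection over the union
    of these finitely many sets gives one \<open>s\<close> in \<open>?S\<close> at which all these
    colours to \<open>t\<close> are null.\<close>
  have "\<forall>j\<in>?J. \<exists>p. p \<subseteq> underS T t \<and> tiny N p \<and>
      (\<forall>s\<in>underS T t \<inter> like e p t. \<not> pos e \<sigma> s {x. c x t = j})"
    using t(3) by simp
  from bchoice[OF this] obtain p where p: "\<forall>j\<in>?J. p j \<subseteq> underS T t \<and> tiny N (p j) \<and>
      (\<forall>s\<in>underS T t \<inter> like e (p j) t. \<not> pos e \<sigma> s {x. c x t = j})" ..
  let ?p = "\<Union>j\<in>?J. p j"
  have "?p \<subseteq> underS T t" using p by blast
  moreover have "tiny N ?p"
    by (rule tiny_UN[OF tiny_finite[OF infinite_N]]) (use p in auto)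
  ultimately have "underS T t \<inter> ?S \<inter> like e ?p t \<noteq> {}" using t(1,2) by blast
  then obtain s where s: "s \<in> underS T t" "s \<in> ?S" "s \<in> like e ?p t" by blast
  have null: "\<not> pos e \<sigma> s {x. c x t = j}" if "j \<in> ?J" for j
  proof -
    have "s \<in> like e (p j) t" using s(3) that by (auto simp: like_def)
    then show ?thesis using p that s(1) by blast
  qed
  \<comment> \<open>\<open>Z\<close> is sought among the nodes above \<open>s\<close> whose label
    over \<open>s\<close> is that of \<open>t\<close>; this set is positive at \<open>t\<close>, and
    on it the null colours at \<open>s\<close> are the same as for \<open>t\<close>.\<close>
  have "{s} \<subseteq> underS T t" using s(1) by blast
  then have "pos e \<sigma> t (UNIV \<inter> like e {s} t)"
    using t(1) by (intro pos_Int_like) (auto simp: tiny_singleton)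
  moreover have "tiny N (Field \<xi>)"
    by (rule tiny_mono[OF \<xi>(2) ordLess_imp_ordLeq[OF card_of_Pow] N_nonempty])
  ultimately obtain Z where Z: "Z \<subseteq> like e {s} t" "rich \<xi> \<sigma> Z" "finite Z \<or> |Z| \<le>o |Field \<xi>|"
    using pos_rich[of e \<xi> \<sigma> t, OF ec \<xi>(1)] by auto
  have sZ: "s \<in> underS T z" if "z \<in> Z" for z using Z(1) that by (auto simp: like_def)
  \<comment> \<open>A colouring of \<open>Z\<close> is coded by its graph, a subset of
    \<open>?W\<close>. As \<open>Z\<close> is finite or no larger than \<xi>, the set of all these
    subsets is tiny.\<close>
  let ?W = "Z \<times> {..<k}"
  have tW: "tiny N (Pow ?W)"
  proof (cases "finite Z")
    case True
    then show ?thesis by (intro tiny_finite[OF infinite_N]) simp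
  next
    case False
    then have inf: "infinite (Field \<xi>)" using Z(3) card_of_ordLeq_infinite by blast
    have "|?W| \<le>o |Field \<xi>|"
      using Z(3) False card_of_finite_ordLeq[OF _ inf] by (intro card_of_Sigma_ordLeq_infinite[OF inf]) auto
    then have "|Pow ?W| \<le>o |Pow (Field \<xi>)|" by (rule card_of_Pow_mono)
    then show ?thesis by (rule tiny_mono[OF \<xi>(2) _ N_nonempty])
  qed
  let ?G = "\<lambda>x. (\<lambda>z. (z, c x z)) ` Z"
  \<comment> \<open>The nodes up to \<open>s\<close> are split by their colours to \<open>Z\<close>.
    By completeness one piece is positive at \<open>s\<close>; its nodes all colour \<open>Z\<close>
    alike.\<close>
  have "pos e \<sigma> s (UNIV \<inter> insert s (underS T s))" using s(2) by (intro pos_restrict) blast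
  moreover have "UNIV \<inter> insert s (underS T s) \<subseteq> (\<Union>G\<in>Pow ?W. {x \<in> insert s (underS T s). ?G x = G})"
    using sZ below_trans colour_less by fastforce
  ultimately have "pos e \<sigma> s (\<Union>G\<in>Pow ?W. {x \<in> insert s (underS T s). ?G x = G})"
    by (rule pos_mono)
  from pos_UN[OF tW this] obtain G where G: "pos e \<sigma> s {x \<in> insert s (underS T s). ?G x = G}" by blast
  let ?Y = "{x \<in> insert s (underS T s). ?G x = G}"
  obtain y where y: "y \<in> ?Y" using pos_nonempty[OF G] by blast
  let ?h = "\<lambda>z. c y z"
  have h: "c x z = ?h z" if "x \<in> ?Y" "z \<in> Z" for x z
  proof -
    have "(z, c x z) \<in> ?G y" using that y by auto
    then show ?thesis by auto
  qed
  have below: "x \<in> underS T z" if "x \<in> ?Y" "z \<in> Z" for x z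
    using that sZ below_trans by blast
  \<comment> \<open>A colour \<open>?h z\<close> outside \<sigma> would be positive at
    \<open>s\<close> with respect to \<open>z\<close>. The label of \<open>z\<close> over
    \<open>s\<close> records this and equals that of \<open>t\<close>, contradicting
    \<open>null\<close>.\<close>
  have "?h ` Z \<subseteq> set \<sigma>"
  proof (rule image_subsetI, rule ccontr)
    fix z assume z: "z \<in> Z" "?h z \<notin> set \<sigma>"
    have k: "?h z < k" using below[OF y z(1)] colour_less by blast
    have "pos e \<sigma> s {x. c x z = ?h z}" by (rule pos_mono[OF G]) (use h z(1) in blast)
    moreover have "e s z = e s t" using Z(1) z(1) by (auto simp: like_def)
    ultimately have "pos e \<sigma> s {x. c x t = ?h z}" using epos[OF _ \<sigma>(1,2) k] by blast
    then show False using null k z(2) by blast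
  qed
  then obtain i g where ig: "i \<in> set \<sigma>" "g ` Field \<xi> \<subseteq> {z \<in> Z. ?h z = i}" "homog i \<xi> g"
    using rich_partition[OF Z(2)] by blast
  \<comment> \<open>The colour \<open>i\<close> found on \<open>Z\<close> belongs to \<sigma>, so
    the positive set \<open>?Y\<close> also has a chain of type \<kappa> in this colour.\<close>
  obtain f where f: "f ` Field \<kappa> \<subseteq> ?Y" "homog i \<kappa> f"
    using pos_homog[OF ec \<kappa> G ig(1)] by blast
  show ?thesis
  proof (rule that[of i f g])
    show "i < k" using ig(1) \<sigma>(2) by blast
    have "?Y \<subseteq> Field T" using s(2) by (auto simp: underS_def Field_def)
    then show "f ` Field \<kappa> \<subseteq> Field T" using f(1) by blast
    show "f a \<in> underS T (g b) \<and> c (f a) (g b) = i" if "a \<in> Field \<kappa>" "b \<in> Field \<xi>" for a b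
    proof -
      have "f a \<in> ?Y" "g b \<in> Z" "?h (g b) = i" using that f(1) ig(2) by blast+
      then show ?thesis using h below by blast
    qed
  qed (use f ig in auto)
qed

end

subsection \<open>Ordinal sums\<close>

lemma osum_cases:
  assumes "p \<in> osum r r'"
  obtains (left) a b where "p = (Inl a, Inl b)" and "(a, b) \<in> r"
    | (right) a b where "p = (Inr a, Inr b)" and "(a, b) \<in> r'"
    | (mixed) a b where "p = (Inl a, Inr b)" and "a \<in> Field r" and "b \<in> Field r'"
  using assms unfolding osum_def by auto

lemma osum_iff:
  "(Inl a, Inl b) \<in> osum r r' \<longleftrightarrow> (a, b) \<in> r"
  "(Inr a', Inr b') \<in> osum r r' \<longleftrightarrow> (a', b') \<in> r'"
  "(Inl a, Inr b') \<in> osum r r' \<longleftrightarrow> a \<in> Field r \<and> b' \<in> Field r'"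
  by (auto simp: osum_def)

lemma Field_osum: "Field (osum r r') = Inl ` Field r \<union> Inr ` Field r'"
proof
  show "Field (osum r r') \<subseteq> Inl ` Field r \<union> Inr ` Field r'"
    by (fastforce simp: osum_def Field_def)
  show "Inl ` Field r \<union> Inr ` Field r' \<subseteq> Field (osum r r')"
    by (force simp: osum_def Field_def)
qed

lemma osum_total:
  assumes r: "Refl r" "Total r" and r': "Refl r'" "Total r'"
    and xy: "x \<in> Field (osum r r')" "y \<in> Field (osum r r')"
  shows "(x, y) \<in> osum r r' \<or> (y, x) \<in> osum r r'"
proof -
  have "(a, b) \<in> r \<or> (b, a) \<in> r" if "a \<in> Field r" "b \<in> Field r" for a b
    using r that by (cases "a = b") (auto simp: refl_on_def total_on_def)
  moreover have "(a, b) \<in> r' \<or> (b, a) \<in> r'" if "a \<in> Field r'" "b \<in> Field r'" for a b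
    using r' that by (cases "a = b") (auto simp: refl_on_def total_on_def)
  ultimately show ?thesis
    using xy unfolding Field_osum by (elim UnE imageE) (simp_all add: osum_iff)
qed

lemma chain_Well_order:
  assumes T: "is_tree T" and H: "H \<in> Chains T"
  shows "Well_order (Restr T H)" and "Field (Restr T H) = H"
proof -
  show F: "Field (Restr T H) = H"
    using H unfolding Chains_def Field_def by blast
  have P: "Partial_order T" using T by (simp add: is_tree_def)
  have "Restr T H - Id \<subseteq> T - Id" by blast
  then have "wf (Restr T H - Id)" using is_tree_wf[OF T] wf_subset by blast
  moreover have "Partial_order (Restr T H)" using Partial_order_Restr[OF P] .
  moreover have "Total (Restr T H)"
    using H unfolding F total_on_def Chains_def by blast
  ultimately show "Well_order (Restr T H)"
    by (simp add: well_order_on_def linear_order_on_def)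
qed

text \<open>A strictly increasing map on a total order reflects the order, so it is an isomorphism
  onto its image, which is a chain.\<close>

lemma osum_embedding:
  assumes T: "is_tree T" and r: "Well_order r" and r': "Well_order r'"
    and FT: "F ` Field (osum r r') \<subseteq> Field T"
    and F: "\<And>x y. (x, y) \<in> osum r r' \<Longrightarrow> x \<noteq> y \<Longrightarrow> F x \<in> underS T (F y)"
  shows "F ` Field (osum r r') \<in> Chains T"
    and "Restr T (F ` Field (osum r r')) =o osum r r'"
proof -
  let ?r = "osum r r'" let ?H = "F ` Field ?r"
  have tot: "(x, y) \<in> ?r \<or> (y, x) \<in> ?r" if "x \<in> Field ?r" "y \<in> Field ?r" for x y
    using r r' osum_total[of r r' x y] that
    by (simp add: well_order_on_def linear_order_on_def partial_order_on_def preorder_on_def)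
  have PT: "refl_on (Field T) T" "antisym T"
    using T by (simp_all add: is_tree_def partial_order_on_def preorder_on_def)
  have mono: "(F x, F y) \<in> T" if "(x, y) \<in> ?r" for x y
  proof (cases "x = y")
    case True
    then have "F x \<in> Field T" using FT that by (auto simp: Field_def)
    then show ?thesis using PT(1) True by (simp add: refl_on_def)
  next
    case False
    then show ?thesis using F[OF that] by (simp add: underS_def)
  qed
  have strict: "F x \<noteq> F y" if "(x, y) \<in> ?r" "x \<noteq> y" for x y
    using F[OF that] by (simp add: underS_def)
  have inj: "inj_on F (Field ?r)"
  proof (rule inj_onI, rule ccontr)
    fix x y assume xy: "x \<in> Field ?r" "y \<in> Field ?r" "F x = F y" "x \<noteq> y"
    then show False using tot[OF xy(1,2)] strict[of x y] strict[of y x] by auto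
  qed
  show H: "?H \<in> Chains T"
    unfolding Chains_def using tot mono by blast
  have reflects: "(x, y) \<in> ?r" if "x \<in> Field ?r" "y \<in> Field ?r" "(F x, F y) \<in> T" for x y
  proof (rule ccontr)
    assume n: "(x, y) \<notin> ?r"
    then have yx: "(y, x) \<in> ?r" using tot that by blast
    then have "F x = F y" using antisymD[OF PT(2) that(3)] mono by blast
    then have "x = y" using inj that by (blast dest: inj_onD)
    then show False using n yx by blast
  qed
  \<comment> \<open>The isomorphism is taken from the chain to the sum, since
    \<open>chain_Well_order\<close> supplies the well-ordering on the side of the chain.\<close>
  let ?G = "inv_into (Field ?r) F"
  have "dir_image (Restr T ?H) ?G = ?r"
  proof
    show "dir_image (Restr T ?H) ?G \<subseteq> ?r"
      using reflects inj unfolding dir_image_def by auto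
    show "?r \<subseteq> dir_image (Restr T ?H) ?G"
    proof (rule subrelI)
      fix x y assume xy: "(x, y) \<in> ?r"
      then have "x \<in> Field ?r" "y \<in> Field ?r" by (auto simp: Field_def)
      then show "(x, y) \<in> dir_image (Restr T ?H) ?G"
        unfolding dir_image_def using mono[OF xy] inj
        by (intro CollectI exI[of _ "F x"] exI[of _ "F y"]) simp
    qed
  qed
  moreover have "inj_on ?G ?H" by (rule inj_on_inv_into) simp
  ultimately show "Restr T ?H =o ?r"
    using dir_image_ordIso[of "Restr T ?H" ?G] chain_Well_order[OF T H] by simp
qed

section \<open>From cardinal arithmetic to the theorem\<close>

lemma tiny_if_cexp_less:
  assumes \<nu>: "Card_order \<nu>" and inf: "infinite (Field \<nu>)" and exp: "is_cexp_less \<nu> \<kappa> \<nu>" and X: "|X| <o \<kappa>" and \<kappa>: "Card_order \<kappa>"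
  shows "tiny (Field \<nu>) X"
proof -
  \<comment> \<open>The exponents in \<open>is_cexp_less\<close> are cardinals on the type of
    \<kappa>, so \<open>X\<close> is first copied into \<open>Field \<kappa>\<close>; the supremum
    \<nu> then bounds the power.\<close>
  have "|X| \<le>o |Field \<kappa>|"
    using X card_of_Field_ordIso[OF \<kappa>] ordLess_imp_ordLeq ordLeq_ordIso_trans ordIso_symmetric by blast
  then obtain g where g: "inj_on g X" "g ` X \<subseteq> Field \<kappa>" using card_of_ordLeq[of X "Field \<kappa>"] by blast
  have eq: "|X| =o |g ` X|" using card_of_ordIsoI inj_on_imp_bij_betw[OF g(1)] by blast
  then have "|g ` X| <o \<kappa>" using X ordIso_ordLess_trans ordIso_symmetric by blast
  then have "\<nu> ^c |g ` X| \<le>o \<nu>"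
    using exp card_of_Card_order[of "g ` X"] unfolding is_cexp_less_def is_csup_def by blast
  then have "|Func (g ` X) (Field \<nu>)| \<le>o |Field \<nu>|"
    using card_of_Field_ordIso[OF \<nu>] ordIso_symmetric ordLeq_ordIso_trans
    unfolding cexp_def Field_card_of by blast
  then have tg: "tiny (Field \<nu>) (g ` X)" by (simp add: tiny_def)
  have "Field \<nu> \<noteq> {}" using inf by auto
  then show ?thesis using tiny_mono[OF tg] eq ordIso_iff_ordLeq by blast
qed

theorem theorem7p2:
  fixes \<nu> :: "'n rel" and \<kappa> :: "'k rel" and \<xi> :: "'x rel" and T :: "'a rel" and k :: nat
  assumes "Cinfinite \<nu>" and "Cinfinite \<kappa>"
    and "is_cexp_less \<nu> \<kappa> \<nu>"
    and "Well_order \<xi>" and "ctwo ^c |Field \<xi>| <o \<kappa>"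
    and "is_tree T" and "\<not> special \<nu> T"
  shows "tree_arrow T (osum \<kappa> \<xi>) k"
  unfolding tree_arrow_def
proof (intro allI impI)
  fix c :: "'a set \<Rightarrow> nat"
  assume c: "c ` chain_pairs T \<subseteq> {..<k}"
  let ?N = "Field \<nu>"
  have \<nu>: "Card_order \<nu>" "infinite ?N" using assms(1) by (simp_all add: cinfinite_def)
  have \<kappa>: "Card_order \<kappa>" "infinite (Field \<kappa>)" using assms(2) by (simp_all add: cinfinite_def)
  have \<kappa>wo: "Well_order \<kappa>" using \<kappa>(1) card_order_on_well_order_on by blast
  have reflT: "refl_on (Field T) T"
    using assms(6) by (simp add: is_tree_def partial_order_on_def preorder_on_def)
  have pair: "{y, x} \<in> chain_pairs T" if "y \<in> underS T x" for x y
  proof -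
    have "y \<noteq> x" "(y, x) \<in> T" using that by (auto simp: underS_def)
    moreover have "(x, x) \<in> T" "(y, y) \<in> T"
      using reflT \<open>(y, x) \<in> T\<close> by (auto simp: refl_on_def Field_def)
    ultimately show ?thesis by (simp add: chain_pairs_def Chains_def)
  qed
  interpret coloured_tree "Field \<nu>" T "\<lambda>y x. c {y, x}" k
    by unfold_locales (use \<nu> assms(6) c pair in auto)
  note tiny_less = tiny_if_cexp_less[OF \<nu> assms(3) _ \<kappa>(1)]
  have "tiny ?N (underS \<kappa> a)" if "a \<in> Field \<kappa>" for a
    using tiny_less card_of_underS[OF \<kappa>(1) that] by blast
  moreover have "|Pow (Field \<xi>)| <o \<kappa>"
    using assms(5) card_of_Pow_Func[of "Field \<xi>"] ordIso_ordLess_trans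
    unfolding cexp_def ctwo_def Field_card_of by blast
  then have "tiny ?N (Pow (Field \<xi>))" by (rule tiny_less)
  moreover have "\<not> small (Field T)"
    using special_if_small_Field card_of_Field_ordIso[OF \<nu>(1)] assms(7) by blast
  ultimately obtain i f g where i: "i < k" and f: "homog i \<kappa> f" and g: "homog i \<xi> g"
    and fT: "f ` Field \<kappa> \<subseteq> Field T"
    and fg: "\<And>a b. a \<in> Field \<kappa> \<Longrightarrow> b \<in> Field \<xi> \<Longrightarrow> f a \<in> underS T (g b) \<and> c {f a, g b} = i"
    using exists_homog[OF \<kappa>wo _ assms(4)] by blast
  let ?r = "osum \<kappa> \<xi>"
  let ?F = "case_sum f g"
  let ?H = "?F ` Field ?r"
  have F: "?F x \<in> underS T (?F y) \<and> c {?F x, ?F y} = i" if "(x, y) \<in> ?r" "x \<noteq> y" for x y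
    using that(1)
  proof (cases rule: osum_cases)
    case (left a b)
    then have "b \<in> Field \<kappa>" "a \<in> underS \<kappa> b" using that(2) by (auto simp: underS_def Field_def)
    then show ?thesis using f left unfolding homog_def by simp
  next
    case (right a b)
    then have "b \<in> Field \<xi>" "a \<in> underS \<xi> b" using that(2) by (auto simp: underS_def Field_def)
    then show ?thesis using g right unfolding homog_def by simp
  next
    case (mixed a b)
    then show ?thesis using fg by simp
  qed
  \<comment> \<open>For a one-point \<xi>, \<open>homog\<close> does not force the value of
    \<open>g\<close> to be a node. As \<kappa> is nonempty, each \<open>g b\<close> lies above some
    \<open>f a\<close>, hence in the tree.\<close>
  obtain a where "a \<in> Field \<kappa>" using \<kappa>(2) by (metis ex_in_conv finite.emptyI)
  then have "g ` Field \<xi> \<subseteq> Field T" using fg by (fastforce simp: underS_def Field_def)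
  then have FT: "?H \<subseteq> Field T" using fT by (auto simp: Field_osum)
  have H: "?H \<in> Chains T" "Restr T ?H =o ?r"
    using osum_embedding[OF assms(6) \<kappa>wo assms(4) FT] F by blast+
  have "c p = i" if p: "p \<in> chain_pairs T" "p \<subseteq> ?H" for p
  proof -
    obtain u v where uv: "p = {u, v}" "u \<noteq> v"
      using p(1) by (auto simp: chain_pairs_def card_2_iff)
    then obtain x y where xy: "x \<in> Field ?r" "y \<in> Field ?r" "u = ?F x" "v = ?F y" using p(2) by blast
    have "(x, y) \<in> ?r \<or> (y, x) \<in> ?r"
      using osum_total[OF _ _ _ _ xy(1,2)] \<kappa>wo assms(4)
      by (simp add: well_order_on_def linear_order_on_def partial_order_on_def preorder_on_def)
    then show ?thesis
      using F[of x y] F[of y x] uv xy by (auto simp: insert_commute)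
  qed
  then show "\<exists>H\<in>Chains T. Restr T H =o ?r \<and> (\<exists>i<k. \<forall>p\<in>chain_pairs T. p \<subseteq> H \<longrightarrow> c p = i)"
    using H i by blast
qed

end
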